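(* Let $D$ be a decidable domain presented by a language $L$, let $L^{+}$ adjoin the parametrised gate $\mathrm{ask}(\cdot)$, and let $(a_k)_{k\in\mathbb{N}}$ be the iterates. If $Q(p)=\{p\}$, then $F_p$ is one of the four unary Boolean functions and the eventual period of $(a_k(p))_{k\in\mathbb{N}}$ is $1$ or $2$. It is $2$ exactly when $F_p$ is negation, that is, exactly when $p$ is a diagonal distinction.
   Context: A domain $D$ presented by a language $L$ with a computable numbering of its systems has a manifestation predicate; it is decidable if it is decidable whether a given system manifests. $L^{+}$ is obtained from $L$ by adjoining a gate $\mathrm{ask}(q)$ with a parameter $q\in\mathbb{N}$; $L^+$ is a decidable set of finite syntactic objects with a fixed computable numbering $\nu:\mathbb{N}\to L^{+}$ extending that of $L$. Assigning a value in $\{0,1\}=\{\text{void},\text{mark}\}$ to every occurring gate turns a system of $L^+$ into a gate-free system of $L$, which is evaluated as in $L$. Iterates: $a_0(p)=0$ for all $p$; $a_{k+1}(p)=1$ if the system $\nu(p)$, evaluated with each occurrence of $\mathrm{ask}(q)$ returning $a_k(q)$, fails to manifest, and $a_{k+1}(p)=0$ otherwise. $Q(p)=\{q:\mathrm{ask}(q)\text{ occurs in }\nu(p)\}$. $F_p:\{0,1\}^{Q(p)}\to\{0,1\}$ sends an assignment of gate values to $1$ if $\nu(p)$, evaluated with those gate values, fails to manifest, and to $0$ otherwise; so $a_{k+1}(p)=F_p(a_k\restriction Q(p))$. A $p$ with $Q(p)=\{p\}$ is a diagonal distinction if $\nu(p)$, evaluated with its gate $\mathrm{ask}(p)$ returning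 $b\in\{0,1\}$, manifests if and only if $b=1$. *)

theory Defs
  imports Main "HOL-Library.Nat_Bijection" "HOL-Library.FuncSet"
begin

text \<open>
  Total recursive functions of arity \<open>n\<close>, given as functions on argument lists of length \<open>n\<close>.
  Minimization is applied to regular functions only, so that every function in the class is total.
  Values at lists of any other length carry no meaning.
\<close>

inductive recursive :: "nat \<Rightarrow> (nat list \<Rightarrow> nat) \<Rightarrow> bool" where
  zero: "recursive n (\<lambda>_. 0)"
| succ: "recursive 1 (\<lambda>xs. Suc (hd xs))"
| proj: "i < n \<Longrightarrow> recursive n (\<lambda>xs. xs ! i)"
| comp: "recursive m f \<Longrightarrow> (\<And>i. i < m \<Longrightarrow> recursive n (g i)) \<Longrightarrow>
    recursive n (\<lambda>xs. f (map (\<lambda>i. g i xs) [0..<m]))"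
| prim_rec: "recursive n f \<Longrightarrow> recursive (n + 2) g \<Longrightarrow>
    recursive (n + 1) (\<lambda>xs. rec_nat (f (tl xs)) (\<lambda>y r. g (y # r # tl xs)) (hd xs))"
| minimize: "recursive (n + 1) f \<Longrightarrow> (\<And>xs. length xs = n \<Longrightarrow> \<exists>y. f (y # xs) = 0) \<Longrightarrow>
    recursive n (\<lambda>xs. LEAST y. f (y # xs) = 0)"

definition computable :: "(nat \<Rightarrow> nat) \<Rightarrow> bool" where
  "computable g \<longleftrightarrow> (\<exists>f. recursive 1 f \<and> (\<forall>n. f [n] = g n))"

definition decidable :: "nat set \<Rightarrow> bool" where
  "decidable A \<longleftrightarrow> computable (\<lambda>n. if n \<in> A then 1 else 0)"

text \<open>
  The finite syntactic objects are words over a countable alphabet: a system of \<open>L\<close> is a word of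
  letters, a system of \<open>L\<^sup>+\<close> a word of letters and gates.
\<close>

type_synonym system = "nat list"

datatype symbol = Letter nat | Ask nat

type_synonym gated_system = "symbol list"

definition code :: "system \<Rightarrow> nat" where
  "code = list_encode"

definition gated_code :: "gated_system \<Rightarrow> nat" where
  "gated_code w =
    list_encode (map (\<lambda>s. case s of Letter c \<Rightarrow> 2 * c | Ask q \<Rightarrow> 2 * q + 1) w)"

record domain =
  lang :: "system set"
  numbering :: "nat \<Rightarrow> system"
  manifests :: "system \<Rightarrow> bool"

definition decidable_domain :: "domain \<Rightarrow> bool" where
  "decidable_domain D \<longleftrightarrow>
    range (numbering D) = lang D \<and>
    computable (\<lambda>n. code (numbering D n)) \<and>
    decidable {n. manifests D (numbering D n)}"

text \<open>
  The fields \<open>void\<close> and \<open>mark\<close> are the expressions that denote the gate values 0 and 1 in the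
  language \<open>L\<close>. Gate values themselves are Booleans, \<open>False\<close> for 0 (void) and \<open>True\<close> for 1 (mark).
\<close>

record ask_language =
  lang_plus :: "gated_system set"
  \<nu> :: "nat \<Rightarrow> gated_system"
  void :: system
  mark :: system

definition gates :: "gated_system \<Rightarrow> nat set" where
  "gates w = {q. Ask q \<in> set w}"

definition fill :: "ask_language \<Rightarrow> (nat \<Rightarrow> bool) \<Rightarrow> gated_system \<Rightarrow> system" where
  "fill E \<beta> w = concat (map (\<lambda>s. case s of
      Letter c \<Rightarrow> [c]
    | Ask q \<Rightarrow> (if \<beta> q then mark E else void E)) w)"

text \<open>
  The numberings of \<open>L\<close> and \<open>L\<^sup>+\<close> are both indexed by all of \<open>\<nat>\<close>, so that \<open>\<nu>\<close> extends the numbering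
  of \<open>L\<close> up to a computable translation of indices. The exact rules for placing gates are left
  open: the gate-free part of \<open>L\<^sup>+\<close> is \<open>L\<close>, every parameter is available, and assigning values to the
  gates always yields a system of \<open>L\<close>.
\<close>

definition adjoins_ask :: "domain \<Rightarrow> ask_language \<Rightarrow> bool" where
  "adjoins_ask D E \<longleftrightarrow>
    void E \<noteq> mark E \<and>
    {w \<in> lang_plus E. gates w = {}} = map Letter ` lang D \<and>
    (\<forall>q. \<exists>w \<in> lang_plus E. q \<in> gates w) \<and>
    (\<forall>w \<in> lang_plus E. \<forall>\<beta>. fill E \<beta> w \<in> lang D) \<and>
    decidable (gated_code ` lang_plus E) \<and>
    range (\<nu> E) = lang_plus E \<and>
    computable (\<lambda>n. gated_code (\<nu> E n)) \<and>
    (\<exists>\<iota>. computable \<iota> \<and> (\<forall>n. \<nu> E (\<iota> n) = map Letter (numbering D n)))"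

primrec iterate :: "domain \<Rightarrow> ask_language \<Rightarrow> nat \<Rightarrow> nat \<Rightarrow> bool" where
  "iterate D E 0 = (\<lambda>p. False)"
| "iterate D E (Suc k) = (\<lambda>p. \<not> manifests D (fill E (iterate D E k) (\<nu> E p)))"

definition Q :: "ask_language \<Rightarrow> nat \<Rightarrow> nat set" where
  "Q E p = gates (\<nu> E p)"

definition F :: "domain \<Rightarrow> ask_language \<Rightarrow> nat \<Rightarrow> (nat \<Rightarrow> bool) \<Rightarrow> bool" where
  "F D E p = (\<lambda>\<beta> \<in> Q E p \<rightarrow>\<^sub>E UNIV. \<not> manifests D (fill E \<beta> (\<nu> E p)))"

lemma fill_restrict: "fill E (restrict \<beta> (gates w)) w = fill E \<beta> w"
  unfolding fill_def gates_def
  by (rule arg_cong[where f = concat]) (auto split: symbol.split)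

lemma iterate_Suc_F: "iterate D E (Suc k) p = F D E p (restrict (iterate D E k) (Q E p))"
  by (simp add: F_def Q_def fill_restrict)

text \<open>
  For \<open>Q(p) = {p}\<close>, the function \<open>F\<^sub>p\<close> as a function of the value of its only gate, under the
  identification of \<open>{0,1}\<^bsup>{p}\<^esup>\<close> with \<open>{0,1}\<close>.
\<close>

definition unary_F :: "domain \<Rightarrow> ask_language \<Rightarrow> nat \<Rightarrow> bool \<Rightarrow> bool" where
  "unary_F D E p b = F D E p (\<lambda>q \<in> {p}. b)"

definition diagonal_distinction :: "domain \<Rightarrow> ask_language \<Rightarrow> nat \<Rightarrow> bool" where
  "diagonal_distinction D E p \<longleftrightarrow>
    Q E p = {p} \<and> (\<forall>b. manifests D (fill E (\<lambda>_. b) (\<nu> E p)) \<longleftrightarrow> b)"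

definition eventually_repeats :: "(nat \<Rightarrow> 'a) \<Rightarrow> nat \<Rightarrow> bool" where
  "eventually_repeats x d \<longleftrightarrow> d > 0 \<and> (\<exists>N. \<forall>k \<ge> N. x (k + d) = x k)"

definition has_eventual_period :: "(nat \<Rightarrow> 'a) \<Rightarrow> nat \<Rightarrow> bool" where
  "has_eventual_period x d \<longleftrightarrow>
    eventually_repeats x d \<and> (\<forall>e. eventually_repeats x e \<longrightarrow> d \<le> e)"

end

theory Submission
  imports Defs
begin

text \<open>The only gate of \<nu>(p) asks about p itself, so the values a_k(p) form the orbit of 0
  under one map u on a two-element set (\<open>iterate_Suc_unary_F\<close>). The constants and the
  identity are idempotent, so their orbits are constant after at most one step
  (\<open>bool_orbit_period_1\<close>). Negation has no fixed point and is an involution, so its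
  orbit alternates with least period 2 (\<open>bool_orbit_period_2\<close>). The least period thus
  detects negation, which is the diagonal case by
  \<open>diagonal_distinction_iff_unary_F\<close>.\<close>

lemma bool_fun_cases:
  fixes u :: "bool \<Rightarrow> bool"
  shows "u \<in> {\<lambda>b. False, \<lambda>b. True, \<lambda>b. b, \<lambda>b. \<not> b}"
  by (cases "u False"; cases "u True") (auto simp: fun_eq_iff all_bool_eq)

lemma has_eventual_period_unique:
  "has_eventual_period x d \<Longrightarrow> has_eventual_period x e \<Longrightarrow> d = e"
  unfolding has_eventual_period_def by (blast intro: le_antisym)

lemma bool_orbit_period_1:
  fixes x :: "nat \<Rightarrow> bool"
  assumes step: "\<And>k. x (Suc k) = u (x k)" and "u \<noteq> (\<lambda>b. \<not> b)"
  shows "has_eventual_period x 1"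
proof -
  have "u (u b) = u b" for b
    using bool_fun_cases[of u] assms(2) by auto
  \<comment> \<open>Index 0 is excluded because \<open>x 0\<close> need not lie in the range of
    \<open>u\<close>: a constant map may change it once.\<close>
  then have "x (k + 1) = x k" if "k \<ge> 1" for k
    using that step by (cases k) auto
  then show ?thesis
    unfolding has_eventual_period_def eventually_repeats_def by auto
qed

lemma bool_orbit_period_2:
  fixes x :: "nat \<Rightarrow> bool"
  assumes step: "\<And>k. x (Suc k) = (\<not> x k)"
  shows "has_eventual_period x 2"
proof -
  \<comment> \<open>Period 1 would make some value of \<open>x\<close> a fixed point of negation.
    Since periods are positive, this is the only smaller candidate to rule out.\<close>
  have "\<not> eventually_repeats x 1"
    using step unfolding eventually_repeats_def by auto
  then have "2 \<le> e" if "eventually_repeats x e" for e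
    using that by (cases "e = 1") (auto simp: eventually_repeats_def)
  moreover have "eventually_repeats x 2"
    using step by (simp add: eventually_repeats_def)
  ultimately show ?thesis
    unfolding has_eventual_period_def by blast
qed

lemma unary_F_eq:
  assumes "Q E p = {p}"
  shows "unary_F D E p b \<longleftrightarrow> \<not> manifests D (fill E (\<lambda>_. b) (\<nu> E p))"
  using assms fill_restrict[of E "\<lambda>_. b" "\<nu> E p"]
  by (simp add: unary_F_def F_def Q_def)

text \<open>On the singleton {p} the assignment given by all the a_k is determined by a_k(p), so the
  recursion closes up at p and involves no other index.\<close>

lemma iterate_Suc_unary_F:
  assumes "Q E p = {p}"
  shows "iterate D E (Suc k) p = unary_F D E p (iterate D E k p)"
proof -
  have "restrict (iterate D E k) {p} = (\<lambda>q \<in> {p}. iterate D E k p)"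
    by (auto simp: restrict_def)
  then show ?thesis
    using assms by (simp only: iterate_Suc_F unary_F_def)
qed

text \<open>F_p records failure to manifest, so manifesting exactly on gate value 1 means that F_p
  inverts its argument.\<close>

lemma diagonal_distinction_iff_unary_F:
  assumes "Q E p = {p}"
  shows "diagonal_distinction D E p \<longleftrightarrow> unary_F D E p = (\<lambda>b. \<not> b)"
  using assms by (auto simp: diagonal_distinction_def unary_F_eq fun_eq_iff)

theorem corollary5p4:
  fixes D :: domain and E :: ask_language and p :: nat
  assumes "decidable_domain D"
    and "adjoins_ask D E"
    and "Q E p = {p}"
  shows "unary_F D E p \<in> {\<lambda>b. False, \<lambda>b. True, \<lambda>b. b, \<lambda>b. \<not> b}
    \<and> (has_eventual_period (\<lambda>k. iterate D E k p) 1 \<or> has_eventual_period (\<lambda>k. iterate D E k p) 2)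
    \<and> (has_eventual_period (\<lambda>k. iterate D E k p) 2 \<longleftrightarrow> unary_F D E p = (\<lambda>b. \<not> b))
    \<and> (has_eventual_period (\<lambda>k. iterate D E k p) 2 \<longleftrightarrow> diagonal_distinction D E p)"
proof -
  let ?x = "\<lambda>k. iterate D E k p"
  note step = iterate_Suc_unary_F[OF assms(3), of D]
  have neg: "has_eventual_period ?x 2" if "unary_F D E p = (\<lambda>b. \<not> b)"
    by (rule bool_orbit_period_2) (simp only: step that)
  have non_neg: "has_eventual_period ?x 1" if "unary_F D E p \<noteq> (\<lambda>b. \<not> b)"
    using step that by (rule bool_orbit_period_1)
  \<comment> \<open>Uniqueness of the least period turns the implications \<open>neg\<close> and
    \<open>non_neg\<close> into the claimed equivalence.\<close>
  have "\<not> (has_eventual_period ?x 1 \<and> has_eventual_period ?x 2)"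
    using has_eventual_period_unique[of ?x 1 2] by auto
  with neg non_neg show ?thesis
    using bool_fun_cases[of "unary_F D E p"] diagonal_distinction_iff_unary_F[OF assms(3)]
    by blast
qed

end
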